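(* Let $A$ be a separable $C^*$-algebra, $B$ a stable $\sigma$-unital $C^*$-algebra, and let $\Phi^\pm:A\to C_b(\mathbb R_+;B)$ be a pair of (not necessarily linear) continuous maps. Then $(\Phi^+,\Phi^-)$ is a compact asymptotic $KK$-cycle from $A$ to $B$ if and only if $(\Phi^+,\Phi^-)$ has the same deficiency from being a homomorphism.
   Context: $\mathbb R_+=[0,\infty)$; $C_b(\mathbb R_+;B)$ is the algebra of bounded norm-continuous $B$-valued functions on $\mathbb R_+$ and $C_0(\mathbb R_+;B)$ its ideal of functions vanishing at infinity. For a pair of continuous maps $\Phi^\pm:A\to C_b(\mathbb R_+;B)$, let $E$ be the $C^*$-algebra generated by all $\Phi^\pm(a)$, $a\in A$, and let $D\subset E$ be the ideal of $E$ generated by $\Phi^+(a)-\Phi^-(a)$, $a\in A$. Condition (a1): $\Phi^\pm(\lambda a)=\lambda\Phi^\pm(a)$ for all $\lambda\in\mathbb C$, $a\in A$, and $\Phi^\pm(a^* )-\Phi^\pm(a)^*\in C_0(\mathbb R_+;B)$ for all $a\in A$. Definition. $(\Phi^+,\Phi^-)$ is a compact asymptotic $KK$-cycle from $A$ to $B$ if (a1) holds and $(\Phi^\pm(a+b)-\Phi^\pm(a)-\Phi^\pm(b))x\in C_0(\mathbb R_+;B)$ and $(\Phi^\pm(ab)-\Phi^\pm(a)\Phi^\pm(b))x\in C_0(\mathbb R_+;B)$ for all $a,b\in A$ and all $x\in D$. Definition. $(\Phi^+,\Phi^-)$ has the same deficiency from being a homomorphism if (a1) holds and $$M^+(a,b)\Phi^+(c_1)\cdots\Phi^+(c_n)-M^-(a,b)\Phi^-(c_1)\cdots\Phi^-(c_n)\in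 C_0(\mathbb R_+;B)$$ for every $n=0,1,2,\ldots$ and all $a,b,c_1,\ldots,c_n\in A$, both when $M^\pm(a,b)=\Phi^\pm(a+b)-\Phi^\pm(a)-\Phi^\pm(b)$ and when $M^\pm(a,b)=\Phi^\pm(ab)-\Phi^\pm(a)\Phi^\pm(b)$. *)

theory Defs
  imports "HOL-Analysis.Analysis"
begin

section \<open>C*-algebras\<close>

text \<open>Not necessarily unital. The real scalar multiplication that comes from the library
  class is required to be the restriction of the complex one.\<close>

class cstar_algebra = real_normed_algebra + banach +
  fixes scaleC :: "complex \<Rightarrow> 'a \<Rightarrow> 'a"  (infixr "*\<^sub>C" 75)
    and star :: "'a \<Rightarrow> 'a"
  assumes scaleC_add_right: "c *\<^sub>C (x + y) = c *\<^sub>C x + c *\<^sub>C y"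
    and scaleC_add_left: "(c + d) *\<^sub>C x = c *\<^sub>C x + d *\<^sub>C x"
    and scaleC_scaleC: "c *\<^sub>C d *\<^sub>C x = (c * d) *\<^sub>C x"
    and scaleC_of_real: "complex_of_real r *\<^sub>C x = r *\<^sub>R x"
    and norm_scaleC: "norm (c *\<^sub>C x) = cmod c * norm x"
    and mult_scaleC_left: "(c *\<^sub>C x) * y = c *\<^sub>C (x * y)"
    and mult_scaleC_right: "x * (c *\<^sub>C y) = c *\<^sub>C (x * y)"
    and star_star: "star (star x) = x"
    and star_add: "star (x + y) = star x + star y"
    and star_scaleC: "star (c *\<^sub>C x) = cnj c *\<^sub>C star x"
    and star_mult: "star (x * y) = star y * star x"
    and cstar_identity: "norm (star x * x) = (norm x)\<^sup>2"

lemma star_zero: "star (0::'a::cstar_algebra) = 0"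
  using star_add[of "0::'a" 0] by simp

lemma star_minus: "star (- x :: 'a::cstar_algebra) = - star x"
  using star_add[of x "- x"] by (simp add: star_zero eq_neg_iff_add_eq_0 add.commute)

lemma star_diff: "star (x - y :: 'a::cstar_algebra) = star x - star y"
  using star_add[of x "- y"] by (simp add: star_minus)

lemma norm_star: "norm (star (x::'a::cstar_algebra)) = norm x"
proof -
  have le: "norm y \<le> norm (star y)" for y :: 'a
  proof (cases "y = 0")
    case False
    have "norm y * norm y \<le> norm (star y) * norm y"
      using norm_mult_ineq[of "star y" y] by (simp add: cstar_identity power2_eq_square)
    with False show ?thesis by simp
  qed simp
  show ?thesis using le[of x] le[of "star x"] by (simp add: star_star)
qed

lemma bounded_linear_star: "bounded_linear (star :: 'a::cstar_algebra \<Rightarrow> 'a)"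
proof (rule bounded_linear_intro[where K = 1])
  show "star (r *\<^sub>R x) = r *\<^sub>R star x" for r and x :: 'a
    using star_scaleC[of "complex_of_real r" x] by (simp add: scaleC_of_real)
qed (simp_all add: star_add norm_star)

lemma bounded_linear_scaleC: "bounded_linear (\<lambda>x::'a::cstar_algebra. c *\<^sub>C x)"
proof (rule bounded_linear_intro[where K = "cmod c"])
  show "c *\<^sub>C (r *\<^sub>R x) = r *\<^sub>R (c *\<^sub>C x)" for r and x :: 'a
    by (simp add: scaleC_of_real[symmetric] scaleC_scaleC mult.commute)
qed (simp_all add: scaleC_add_right norm_scaleC mult.commute)

definition cstar_subalgebra :: "'a::cstar_algebra set \<Rightarrow> bool" where
  "cstar_subalgebra S \<longleftrightarrow> 0 \<in> S \<and> closed S \<and>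
     (\<forall>x\<in>S. \<forall>y\<in>S. x + y \<in> S \<and> x * y \<in> S) \<and> (\<forall>x\<in>S. star x \<in> S \<and> (\<forall>c. c *\<^sub>C x \<in> S))"

definition closed_ideal_of :: "'a::cstar_algebra set \<Rightarrow> 'a set \<Rightarrow> bool" where
  "closed_ideal_of S J \<longleftrightarrow> J \<subseteq> S \<and> 0 \<in> J \<and> closed J \<and>
     (\<forall>x\<in>J. \<forall>y\<in>J. x + y \<in> J) \<and> (\<forall>x\<in>J. \<forall>c. c *\<^sub>C x \<in> J) \<and>
     (\<forall>x\<in>J. \<forall>y\<in>S. x * y \<in> J \<and> y * x \<in> J)"

definition positive :: "'a::cstar_algebra \<Rightarrow> bool" where
  "positive a \<longleftrightarrow> (\<exists>x. a = star x * x)"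

text \<open>A C*-algebra is \<open>\<sigma>\<close>-unital if it has a countable approximate unit.\<close>

definition sigma_unital :: "'b::cstar_algebra itself \<Rightarrow> bool" where
  "sigma_unital _ \<longleftrightarrow> (\<exists>e :: nat \<Rightarrow> 'b.
     (\<forall>n. positive (e n) \<and> norm (e n) \<le> 1 \<and> positive (e (Suc n) - e n)) \<and>
     (\<forall>b. (\<lambda>n. e n * b) \<longlonglongrightarrow> b \<and> (\<lambda>n. b * e n) \<longlonglongrightarrow> b))"


section \<open>Stability\<close>

text \<open>The norm of the C*-algebra \<open>M\<^sub>n(B)\<close>, realised as the operator norm
  for the left action of matrices on the Hilbert \<open>B\<close>-module \<open>B\<^sup>n\<close>, whose norm is
  \<open>\<parallel>\<Sum>\<^sub>j v\<^sub>j\<^sup>* v\<^sub>j\<parallel>\<^sup>1\<^sup>/\<^sup>2\<close>. Of the infinite matrix \<open>X\<close> only the upper left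
  \<open>n \<times> n\<close> block matters.\<close>

definition matrix_norm :: "nat \<Rightarrow> (nat \<Rightarrow> nat \<Rightarrow> 'b::cstar_algebra) \<Rightarrow> real" where
  "matrix_norm n X =
     (SUP v \<in> {v :: nat \<Rightarrow> 'b. norm (\<Sum>j<n. star (v j) * v j) \<le> 1}.
        sqrt (norm (\<Sum>i<n. star (\<Sum>j<n. X i j * v j) * (\<Sum>j<n. X i j * v j))))"

definition finite_matrix :: "(nat \<Rightarrow> nat \<Rightarrow> 'b::zero) \<Rightarrow> bool" where
  "finite_matrix X \<longleftrightarrow> (\<exists>N. \<forall>i j. N \<le> i \<or> N \<le> j \<longrightarrow> X i j = 0)"

text \<open>The C*-algebra \<open>B \<otimes> K\<close>, with \<open>K\<close> the compact operators on \<open>\<ell>\<^sup>2(\<nat>)\<close>: the completion of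
  the increasing union of the \<open>M\<^sub>n(B) = B \<otimes> M\<^sub>n\<close>, realised by infinite matrices (as operators
  on the Hilbert module \<open>\<ell>\<^sup>2(B)\<close>). A bound that is uniform in \<open>n\<close> on the norms of the
  \<open>n \<times> n\<close> blocks is a bound on the operator norm of an infinite matrix, so these are the
  norm limits of finite matrices.\<close>

definition stabilization :: "(nat \<Rightarrow> nat \<Rightarrow> 'b::cstar_algebra) set" where
  "stabilization = {X. \<forall>\<epsilon>>0. \<exists>F. finite_matrix F \<and>
     (\<forall>n. matrix_norm n (\<lambda>i j. X i j - F i j) \<le> \<epsilon>)}"

text \<open>\<open>B\<close> is stable if it is *-isomorphic to \<open>B \<otimes> K\<close>; in the latter the operations are those
  of matrices.\<close>

definition stable_cstar :: "'b::cstar_algebra itself \<Rightarrow> bool" where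
  "stable_cstar _ \<longleftrightarrow> (\<exists>\<phi> :: 'b \<Rightarrow> nat \<Rightarrow> nat \<Rightarrow> 'b.
     bij_betw \<phi> UNIV stabilization \<and>
     (\<forall>x y i j. \<phi> (x + y) i j = \<phi> x i j + \<phi> y i j) \<and>
     (\<forall>c x i j. \<phi> (c *\<^sub>C x) i j = c *\<^sub>C \<phi> x i j) \<and>
     (\<forall>x y i j. (\<lambda>k. \<phi> x i k * \<phi> y k j) sums \<phi> (x * y) i j) \<and>
     (\<forall>x i j. \<phi> (star x) i j = star (\<phi> x j i)))"


section \<open>The C*-algebra of bounded continuous functions\<close>

lemma bcontfun_mult:
  fixes f g :: "'t::topological_space \<Rightarrow> 'b::real_normed_algebra"
  assumes "f \<in> bcontfun" "g \<in> bcontfun"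
  shows "(\<lambda>t. f t * g t) \<in> bcontfun"
proof -
  obtain K L where K: "\<And>t. norm (f t) \<le> K" and L: "\<And>t. norm (g t) \<le> L"
    using assms by (auto simp: bcontfun_def bounded_iff)
  have "norm (f t * g t) \<le> K * L" for t
    by (intro order_trans[OF norm_mult_ineq] mult_mono K L norm_ge_zero
        order_trans[OF norm_ge_zero K])
  then show ?thesis
    using assms by (intro bcontfun_normI) (auto simp: bcontfun_def intro!: continuous_intros)
qed

lemma bcontfun_bounded_linear:
  assumes "bounded_linear h" and "f \<in> bcontfun"
  shows "(\<lambda>t. h (f t)) \<in> bcontfun"
  using assms bounded_linear_image[OF _ assms(1), of "range f"]
  by (auto simp: bcontfun_def image_image intro: bounded_linear.continuous_on)

instantiation bcontfun :: (topological_space, real_normed_algebra) real_normed_algebra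
begin

definition times_bcontfun :: "('a \<Rightarrow>\<^sub>C 'b) \<Rightarrow> ('a \<Rightarrow>\<^sub>C 'b) \<Rightarrow> ('a \<Rightarrow>\<^sub>C 'b)" where
  "times_bcontfun f g = Bcontfun (\<lambda>t. apply_bcontfun f t * apply_bcontfun g t)"

lemma apply_times_bcontfun [simp]:
  "apply_bcontfun (f * g) t = apply_bcontfun f t * apply_bcontfun (g :: 'a \<Rightarrow>\<^sub>C 'b) t"
  by (simp add: times_bcontfun_def Bcontfun_inverse bcontfun_mult apply_bcontfun)

instance
proof
  fix f g h :: "'a \<Rightarrow>\<^sub>C 'b" and r :: real
  show "f * g * h = f * (g * h)" "(f + g) * h = f * h + g * h" "f * (g + h) = f * g + f * h"
    "r *\<^sub>R f * g = r *\<^sub>R (f * g)" "f * r *\<^sub>R g = r *\<^sub>R (f * g)"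
    by (auto intro!: bcontfun_eqI simp: algebra_simps)
  show "norm (f * g) \<le> norm f * norm g"
  proof (rule norm_bound)
    fix t
    have "norm (apply_bcontfun f t * apply_bcontfun g t)
        \<le> norm (apply_bcontfun f t) * norm (apply_bcontfun g t)"
      by (rule norm_mult_ineq)
    also have "\<dots> \<le> norm f * norm g"
      by (intro mult_mono norm_bounded norm_ge_zero)
    finally show "norm (apply_bcontfun (f * g) t) \<le> norm f * norm g" by simp
  qed
qed

end

instance bcontfun :: (metric_space, banach) banach ..

instantiation bcontfun :: (metric_space, cstar_algebra) cstar_algebra
begin

definition scaleC_bcontfun :: "complex \<Rightarrow> ('a \<Rightarrow>\<^sub>C 'b) \<Rightarrow> ('a \<Rightarrow>\<^sub>C 'b)" where
  "scaleC_bcontfun c f = Bcontfun (\<lambda>t. c *\<^sub>C apply_bcontfun f t)"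

definition star_bcontfun :: "('a \<Rightarrow>\<^sub>C 'b) \<Rightarrow> ('a \<Rightarrow>\<^sub>C 'b)" where
  "star_bcontfun f = Bcontfun (\<lambda>t. star (apply_bcontfun f t))"

lemma apply_scaleC_bcontfun [simp]:
  "apply_bcontfun (c *\<^sub>C f) t = c *\<^sub>C apply_bcontfun (f :: 'a \<Rightarrow>\<^sub>C 'b) t"
  by (simp add: scaleC_bcontfun_def Bcontfun_inverse
      bcontfun_bounded_linear[OF bounded_linear_scaleC] apply_bcontfun)

lemma apply_star_bcontfun [simp]:
  "apply_bcontfun (star f) t = star (apply_bcontfun (f :: 'a \<Rightarrow>\<^sub>C 'b) t)"
  by (simp add: star_bcontfun_def Bcontfun_inverse
      bcontfun_bounded_linear[OF bounded_linear_star] apply_bcontfun)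

instance
proof
  fix f g h :: "'a \<Rightarrow>\<^sub>C 'b" and c d :: complex and r :: real
  show "c *\<^sub>C (f + g) = c *\<^sub>C f + c *\<^sub>C g" "(c + d) *\<^sub>C f = c *\<^sub>C f + d *\<^sub>C f"
    "c *\<^sub>C d *\<^sub>C f = (c * d) *\<^sub>C f" "complex_of_real r *\<^sub>C f = r *\<^sub>R f"
    "c *\<^sub>C f * g = c *\<^sub>C (f * g)" "f * c *\<^sub>C g = c *\<^sub>C (f * g)"
    "star (star f) = f" "star (f + g) = star f + star g"
    "star (c *\<^sub>C f) = cnj c *\<^sub>C star f" "star (f * g) = star g * star f"
    by (auto intro!: bcontfun_eqI simp: scaleC_add_right scaleC_add_left scaleC_scaleC
        scaleC_of_real mult_scaleC_left mult_scaleC_right star_star star_add star_scaleC star_mult)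
  have le: "norm (c *\<^sub>C k) \<le> cmod c * norm k" for c and k :: "'a \<Rightarrow>\<^sub>C 'b"
    by (rule norm_bound) (simp add: norm_scaleC mult_left_mono norm_bounded)
  have one: "1 *\<^sub>C k = k" for k :: "'a \<Rightarrow>\<^sub>C 'b"
    using scaleC_of_real[of 1] by (auto intro!: bcontfun_eqI)
  show "norm (c *\<^sub>C f) = cmod c * norm f"
  proof (cases "c = 0")
    case False
    have "norm f = norm (inverse c *\<^sub>C c *\<^sub>C f)"
    proof -
      have "inverse c *\<^sub>C c *\<^sub>C f = 1 *\<^sub>C f"
        using False by (intro bcontfun_eqI) (simp add: scaleC_scaleC)
      then show ?thesis by (simp add: one)
    qed
    also have "\<dots> \<le> cmod (inverse c) * norm (c *\<^sub>C f)" by (rule le)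
    finally have "norm f \<le> inverse (cmod c) * norm (c *\<^sub>C f)" by (simp only: norm_inverse)
    then have "cmod c * norm f \<le> cmod c * (inverse (cmod c) * norm (c *\<^sub>C f))"
      by (rule mult_left_mono) simp
    also have "\<dots> = norm (c *\<^sub>C f)" using False by simp
    finally have "cmod c * norm f \<le> norm (c *\<^sub>C f)" .
    with le[of c f] show ?thesis by simp
  next
    case True
    then show ?thesis using le[of c f] by simp
  qed
  have star_le: "norm (star k) \<le> norm k" for k :: "'a \<Rightarrow>\<^sub>C 'b"
    by (rule norm_bound) (simp add: norm_star norm_bounded)
  show "norm (star f * f) = (norm f)\<^sup>2"
  proof (rule antisym)
    show "norm (star f * f) \<le> (norm f)\<^sup>2"
      using norm_mult_ineq[of "star f" f] mult_right_mono[OF star_le[of f], of "norm f"]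
      by (simp add: power2_eq_square)
    have "norm f \<le> sqrt (norm (star f * f))"
    proof (rule norm_bound)
      fix t
      have "(norm (apply_bcontfun f t))\<^sup>2 \<le> norm (star f * f)"
        using norm_bounded[of "star f * f" t] by (simp add: cstar_identity)
      then show "norm (apply_bcontfun f t) \<le> sqrt (norm (star f * f))"
        by (rule real_le_rsqrt)
    qed
    then show "(norm f)\<^sup>2 \<le> norm (star f * f)"
      using power_mono[of "norm f" "sqrt (norm (star f * f))" 2] by simp
  qed
qed

end


section \<open>The half-line\<close>

typedef nnreal = "{0..} :: real set"
  morphisms real_of_nnreal Abs_nnreal
  by auto

instantiation nnreal :: metric_space
begin

definition dist_nnreal :: "nnreal \<Rightarrow> nnreal \<Rightarrow> real" where
  "dist_nnreal s t = dist (real_of_nnreal s) (real_of_nnreal t)"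

definition uniformity_nnreal :: "(nnreal \<times> nnreal) filter" where
  "uniformity_nnreal = (INF e\<in>{0<..}. principal {(s, t). dist s t < e})"

definition open_nnreal :: "nnreal set \<Rightarrow> bool" where
  "open_nnreal U = (\<forall>s\<in>U. \<forall>\<^sub>F (s', t) in uniformity. s' = s \<longrightarrow> t \<in> U)"

instance
  by standard (auto simp: dist_nnreal_def uniformity_nnreal_def open_nnreal_def
      real_of_nnreal_inject dist_triangle2)

end

text \<open>\<open>nnreal \<Rightarrow>\<^sub>C 'b\<close> is \<open>C\<^sub>b(\<real>\<^sub>+; B)\<close>; the following is its ideal \<open>C\<^sub>0(\<real>\<^sub>+; B)\<close>,
  where the filter expresses \<open>t \<rightarrow> \<infinity>\<close>.\<close>

definition C0 :: "(nnreal \<Rightarrow>\<^sub>C 'b::cstar_algebra) set" where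
  "C0 = {f. (apply_bcontfun f \<longlongrightarrow> 0) (filtercomap real_of_nnreal at_top)}"


section \<open>Compact asymptotic KK-cycles and equal deficiency\<close>

type_synonym ('a, 'b) asym_map = "'a \<Rightarrow> (nnreal \<Rightarrow>\<^sub>C 'b)"

definition generated_algebra ::
  "('a::cstar_algebra, 'b::cstar_algebra) asym_map \<Rightarrow> ('a, 'b) asym_map \<Rightarrow> (nnreal \<Rightarrow>\<^sub>C 'b) set" where
  "generated_algebra \<Phi>p \<Phi>m = cstar_subalgebra hull (range \<Phi>p \<union> range \<Phi>m)"

text \<open>As usual for C*-algebras, ideals are closed and two-sided.\<close>

definition difference_ideal ::
  "('a::cstar_algebra, 'b::cstar_algebra) asym_map \<Rightarrow> ('a, 'b) asym_map \<Rightarrow> (nnreal \<Rightarrow>\<^sub>C 'b) set" where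
  "difference_ideal \<Phi>p \<Phi>m =
     closed_ideal_of (generated_algebra \<Phi>p \<Phi>m) hull (range (\<lambda>a. \<Phi>p a - \<Phi>m a))"

definition homogeneous_asym_star :: "('a::cstar_algebra, 'b::cstar_algebra) asym_map \<Rightarrow> bool" where
  "homogeneous_asym_star \<Phi> \<longleftrightarrow>
     (\<forall>c a. \<Phi> (c *\<^sub>C a) = c *\<^sub>C \<Phi> a) \<and> (\<forall>a. \<Phi> (star a) - star (\<Phi> a) \<in> C0)"

definition add_defect ::
  "('a::cstar_algebra, 'b::cstar_algebra) asym_map \<Rightarrow> 'a \<Rightarrow> 'a \<Rightarrow> (nnreal \<Rightarrow>\<^sub>C 'b)" where
  "add_defect \<Phi> a b = \<Phi> (a + b) - \<Phi> a - \<Phi> b"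

definition mult_defect ::
  "('a::cstar_algebra, 'b::cstar_algebra) asym_map \<Rightarrow> 'a \<Rightarrow> 'a \<Rightarrow> (nnreal \<Rightarrow>\<^sub>C 'b)" where
  "mult_defect \<Phi> a b = \<Phi> (a * b) - \<Phi> a * \<Phi> b"

definition compact_asymptotic_KK_cycle ::
  "('a::cstar_algebra, 'b::cstar_algebra) asym_map \<Rightarrow> ('a, 'b) asym_map \<Rightarrow> bool" where
  "compact_asymptotic_KK_cycle \<Phi>p \<Phi>m \<longleftrightarrow>
     homogeneous_asym_star \<Phi>p \<and> homogeneous_asym_star \<Phi>m \<and>
     (\<forall>\<Phi>\<in>{\<Phi>p, \<Phi>m}. \<forall>a b. \<forall>x\<in>difference_ideal \<Phi>p \<Phi>m.
        add_defect \<Phi> a b * x \<in> C0 \<and> mult_defect \<Phi> a b * x \<in> C0)"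

text \<open>\<open>m \<cdot> \<Phi>(c\<^sub>1) \<cdots> \<Phi>(c\<^sub>n)\<close>. There need not be a unit, so the case \<open>n = 0\<close> is covered by starting
  the product with \<open>m\<close>.\<close>

definition mult_word ::
  "('a::cstar_algebra, 'b::cstar_algebra) asym_map \<Rightarrow> (nnreal \<Rightarrow>\<^sub>C 'b) \<Rightarrow> 'a list \<Rightarrow> (nnreal \<Rightarrow>\<^sub>C 'b)" where
  "mult_word \<Phi> m cs = foldl (\<lambda>y c. y * \<Phi> c) m cs"

definition same_deficiency ::
  "('a::cstar_algebra, 'b::cstar_algebra) asym_map \<Rightarrow> ('a, 'b) asym_map \<Rightarrow> bool" where
  "same_deficiency \<Phi>p \<Phi>m \<longleftrightarrow>
     homogeneous_asym_star \<Phi>p \<and> homogeneous_asym_star \<Phi>m \<and>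
     (\<forall>a b cs.
        mult_word \<Phi>p (add_defect \<Phi>p a b) cs - mult_word \<Phi>m (add_defect \<Phi>m a b) cs \<in> C0 \<and>
        mult_word \<Phi>p (mult_defect \<Phi>p a b) cs - mult_word \<Phi>m (mult_defect \<Phi>m a b) cs \<in> C0)"

end

theory Submission
  imports Defs
begin

text \<open>
  Work modulo \<open>C\<^sub>0(\<real>\<^sub>+; B)\<close> and put \<open>d(a) = \<Phi>\<^sup>+(a) - \<Phi>\<^sup>-(a)\<close>. If the defects \<open>M\<^sup>\<plusminus>\<close> annihilate \<open>D\<close>,
  then \<open>z = M\<^sup>+ - M\<^sup>-\<close> lies in \<open>D\<close>, and \<open>D\<close> is self-adjoint modulo \<open>C\<^sub>0\<close> because
  \<open>d(a)\<^sup>* = d(a\<^sup>*)\<close> there; hence \<open>z z\<^sup>* = 0\<close>, so \<open>z = 0\<close> by the C*-identity. Longer words follow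
  by replacing one factor \<open>\<Phi>\<^sup>+(c)\<close> by \<open>\<Phi>\<^sup>-(c)\<close> at a time. Conversely, equal
  deficiency for words of lengths \<open>n\<close> and \<open>n + 1\<close> gives
  \<open>M\<^sup>\<plusminus> \<Phi>\<^sup>+(c\<^sub>1) \<cdots> \<Phi>\<^sup>+(c\<^sub>n) d(c) = 0\<close>. The elements \<open>v\<close> with
  \<open>v \<Phi>\<^sup>+(c\<^sub>1) \<cdots> \<Phi>\<^sup>+(c\<^sub>n) d(c) = 0\<close> for all words form a right \<open>E\<close>-module,
  so \<open>M\<^sup>\<plusminus> E d(c) = 0\<close> and \<open>M\<^sup>\<plusminus> D = 0\<close>.
\<close>

section \<open>Closed ideals and hulls in C*-algebras\<close>

lemma scaleC_minus_one: "(- 1) *\<^sub>C x = - (x::'a::cstar_algebra)"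
  using scaleC_of_real[of "- 1" x] by simp

lemmas continuous_on_star [continuous_intros] =
  bounded_linear.continuous_on[OF bounded_linear_star]

lemma cstar_subalgebra_hull: "cstar_subalgebra (cstar_subalgebra hull X)"
  by (rule hull_in) (auto simp: cstar_subalgebra_def)

lemma cstar_subalgebra_imp_closed_ideal: "cstar_subalgebra S \<Longrightarrow> closed_ideal_of S S"
  by (auto simp: cstar_subalgebra_def closed_ideal_of_def)

text \<open>\<open>S\<close> is itself a closed ideal containing \<open>X\<close>, so the
  intersection runs over a nonempty family and stays inside \<open>S\<close>; the other closure
  properties pass to intersections.\<close>

lemma closed_ideal_of_hull:
  assumes "cstar_subalgebra S" "X \<subseteq> S"
  shows "closed_ideal_of S (closed_ideal_of S hull X)"
proof -
  have "closed_ideal_of S hull X \<subseteq> S"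
    using assms by (intro hull_minimal cstar_subalgebra_imp_closed_ideal)
  then show ?thesis
    unfolding closed_ideal_of_def by (auto simp: hull_def)
qed

lemma closed_ideal_of_diff:
  assumes "closed_ideal_of S J" "x \<in> J" "y \<in> J"
  shows "x - y \<in> J"
proof -
  have "x + (- 1) *\<^sub>C y \<in> J" using assms unfolding closed_ideal_of_def by blast
  then show ?thesis by (simp add: scaleC_minus_one)
qed

section \<open>Functions vanishing at infinity as a closed ideal\<close>

lemma C0_iff:
  "f \<in> C0 \<longleftrightarrow>
     (\<forall>e>0. \<forall>\<^sub>F t in filtercomap real_of_nnreal at_top. norm (apply_bcontfun f t) < e)"
  by (simp add: C0_def tendsto_iff dist_norm)

lemma C0_zero: "0 \<in> C0"
  by (simp add: C0_iff)

lemma C0_add: "f \<in> C0 \<Longrightarrow> g \<in> C0 \<Longrightarrow> f + g \<in> C0"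
  using tendsto_add[of "apply_bcontfun f" 0 _ "apply_bcontfun g" 0] by (simp add: C0_def fun_eq_iff)

lemma C0_bounded_linear:
  assumes "bounded_linear h" "f \<in> C0" "\<And>t. apply_bcontfun g t = h (apply_bcontfun f t)"
  shows "g \<in> C0"
proof -
  have "apply_bcontfun g = (\<lambda>t. h (apply_bcontfun f t))" using assms(3) by (rule ext)
  then show ?thesis
    using bounded_linear.tendsto_zero[OF assms(1)] assms(2) by (simp add: C0_def)
qed

lemma C0_scaleC: "f \<in> C0 \<Longrightarrow> c *\<^sub>C f \<in> C0"
  by (rule C0_bounded_linear[OF bounded_linear_scaleC]) simp_all

lemma C0_star: "f \<in> C0 \<Longrightarrow> star f \<in> C0"
  by (rule C0_bounded_linear[OF bounded_linear_star]) simp_all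

lemma C0_dominated:
  assumes "f \<in> C0" "\<And>t. norm (apply_bcontfun g t) \<le> norm (apply_bcontfun f t) * K"
  shows "g \<in> C0"
  using assms tendsto_0_le[where f = "apply_bcontfun f" and g = "apply_bcontfun g" and K = K]
  by (auto simp: C0_def)

lemma C0_mult_right:
  assumes "f \<in> C0" shows "f * g \<in> C0"
  using assms
proof (rule C0_dominated[where K = "norm g"])
  show "norm (apply_bcontfun (f * g) t) \<le> norm (apply_bcontfun f t) * norm g" for t
    using order_trans[OF norm_mult_ineq mult_left_mono[OF norm_bounded norm_ge_zero]] by simp
qed

text \<open>Taking adjoints turns left multiplication into right multiplication.\<close>

lemma C0_mult_left:
  assumes "f \<in> C0" shows "g * f \<in> C0"
  using C0_star[OF C0_mult_right[OF C0_star[OF assms], of "star g"]]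
  by (simp add: star_mult star_star)

lemma closed_C0: "closed (C0 :: (nnreal \<Rightarrow>\<^sub>C 'b::cstar_algebra) set)"
proof -
  have "f \<in> C0" if f: "f \<in> closure C0" for f :: "nnreal \<Rightarrow>\<^sub>C 'b"
    unfolding C0_iff
  proof (intro allI impI)
    fix e :: real assume "e > 0"
    then obtain g where g: "g \<in> C0" "dist g f < e / 2"
      using f by (meson closure_approachable half_gt_zero)
    have "\<forall>\<^sub>F t in filtercomap real_of_nnreal at_top. norm (apply_bcontfun g t) < e / 2"
      using g(1) \<open>e > 0\<close> half_gt_zero unfolding C0_iff by blast
    then show "\<forall>\<^sub>F t in filtercomap real_of_nnreal at_top. norm (apply_bcontfun f t) < e"
    proof eventually_elim
      case (elim t)
      have "norm (apply_bcontfun (f - g) t) < e / 2"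
        using norm_bounded[of "f - g" t] g by (simp add: dist_norm norm_minus_commute)
      with elim norm_triangle_sub[of "apply_bcontfun f t" "apply_bcontfun g t"]
      show ?case by simp
    qed
  qed
  then show "closed (C0 :: (nnreal \<Rightarrow>\<^sub>C 'b) set)"
    by (metis closure_subset closed_closure subsetI subset_antisym)
qed

lemma closed_ideal_C0: "closed_ideal_of UNIV C0"
  by (simp add: closed_ideal_of_def C0_zero C0_add C0_scaleC C0_mult_left C0_mult_right closed_C0)

lemmas C0_diff = closed_ideal_of_diff[OF closed_ideal_C0]

lemma C0_diff_cancel: "f - g \<in> C0 \<Longrightarrow> f \<in> C0 \<longleftrightarrow> g \<in> C0"
  using C0_add[of "f - g" g] C0_diff[of f "f - g"] by auto

text \<open>The C*-identity at each point \<open>t\<close> bounds the square of the norm of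
  \<open>f\<close> by the norm of \<open>f * star f\<close>; this replaces the C*-identity of the
  quotient by \<open>C0\<close>.\<close>

lemma C0_mult_star_self:
  assumes "f * star f \<in> C0" shows "f \<in> C0"
  unfolding C0_iff
proof (intro allI impI)
  fix e :: real assume "e > 0"
  then have "\<forall>\<^sub>F t in filtercomap real_of_nnreal at_top.
      norm (apply_bcontfun (f * star f) t) < e\<^sup>2"
    using assms by (simp only: C0_iff zero_less_power)
  then show "\<forall>\<^sub>F t in filtercomap real_of_nnreal at_top. norm (apply_bcontfun f t) < e"
  proof eventually_elim
    case (elim t)
    then have "(norm (apply_bcontfun f t))\<^sup>2 < e\<^sup>2"
      using cstar_identity[of "star (apply_bcontfun f t)"] by (simp add: star_star norm_star)
    with \<open>e > 0\<close> show ?case by (simp add: power_less_imp_less_base)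
  qed
qed

lemma closed_C0_vimage:
  fixes f :: "(nnreal \<Rightarrow>\<^sub>C 'b::cstar_algebra) \<Rightarrow> (nnreal \<Rightarrow>\<^sub>C 'b)"
  assumes "continuous_on UNIV f"
  shows "closed {x. f x \<in> C0}"
  using closed_vimage[OF closed_C0 assms] by (simp add: vimage_def)

section \<open>Words as continuous linear functions of their first factor\<close>

lemma mult_word_snoc: "mult_word \<Phi> m (cs @ [c]) = mult_word \<Phi> m cs * \<Phi> c"
  by (simp add: mult_word_def)

lemma mult_word_add: "mult_word \<Phi> (m + n) cs = mult_word \<Phi> m cs + mult_word \<Phi> n cs"
  by (induction cs rule: rev_induct) (simp_all add: mult_word_def algebra_simps)

lemma mult_word_scaleC: "mult_word \<Phi> (c *\<^sub>C m) cs = c *\<^sub>C mult_word \<Phi> m cs"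
  by (induction cs rule: rev_induct) (simp_all add: mult_word_def mult_scaleC_left)

lemma continuous_on_mult_word: "continuous_on UNIV (\<lambda>m. mult_word \<Phi> m cs)"
  by (induction cs rule: rev_induct) (auto simp: mult_word_def intro!: continuous_intros)

lemma mult_word_C0: "m \<in> C0 \<Longrightarrow> mult_word \<Phi> m cs \<in> C0"
  by (induction cs rule: rev_induct) (simp_all add: mult_word_def C0_mult_right)

section \<open>The generated algebra and the difference ideal\<close>

context
  fixes \<Phi>p \<Phi>m :: "'a::cstar_algebra \<Rightarrow> (nnreal \<Rightarrow>\<^sub>C 'b::cstar_algebra)"
begin

abbreviation "E \<equiv> generated_algebra \<Phi>p \<Phi>m"
abbreviation "D \<equiv> difference_ideal \<Phi>p \<Phi>m"

lemma cstar_subalgebra_E: "cstar_subalgebra E"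
  by (simp add: generated_algebra_def cstar_subalgebra_hull)

lemma \<Phi>_in_E: "\<Phi>p a \<in> E" "\<Phi>m a \<in> E"
  unfolding generated_algebra_def by (auto intro: hull_inc)

lemma E_closed:
  assumes "x \<in> E" "y \<in> E"
  shows "x + y \<in> E" "x * y \<in> E" "star x \<in> E" "c *\<^sub>C x \<in> E" "x - y \<in> E"
  using assms cstar_subalgebra_E
    closed_ideal_of_diff[OF cstar_subalgebra_imp_closed_ideal[OF cstar_subalgebra_E]]
  by (auto simp: cstar_subalgebra_def)

lemma closed_ideal_D: "closed_ideal_of E D"
  unfolding difference_ideal_def
  by (rule closed_ideal_of_hull) (auto simp: cstar_subalgebra_E \<Phi>_in_E E_closed)

lemma difference_in_D: "\<Phi>p a - \<Phi>m a \<in> D"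
  unfolding difference_ideal_def by (auto intro: hull_inc)

lemma D_closed:
  assumes "x \<in> D"
  shows "x \<in> E" "y \<in> D \<Longrightarrow> x + y \<in> D" "y \<in> D \<Longrightarrow> x - y \<in> D" "c *\<^sub>C x \<in> D"
    "y \<in> E \<Longrightarrow> x * y \<in> D" "y \<in> E \<Longrightarrow> y * x \<in> D"
  using closed_ideal_D assms closed_ideal_of_diff[OF closed_ideal_D]
  by (auto simp: closed_ideal_of_def)

lemma D_minimal:
  assumes "closed_ideal_of E J" "\<And>a. \<Phi>p a - \<Phi>m a \<in> J"
  shows "D \<subseteq> J"
  unfolding difference_ideal_def using assms by (intro hull_minimal) auto

lemma add_defect_diff_in_D: "add_defect \<Phi>p a b - add_defect \<Phi>m a b \<in> D"
proof -
  have "add_defect \<Phi>p a b - add_defect \<Phi>m a b =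
      (\<Phi>p (a + b) - \<Phi>m (a + b)) - (\<Phi>p a - \<Phi>m a) - (\<Phi>p b - \<Phi>m b)"
    by (simp add: add_defect_def)
  then show ?thesis by (simp only: D_closed(3) difference_in_D)
qed

text \<open>The difference of the two products telescopes, changing one factor at a time.\<close>

lemma mult_defect_diff_in_D: "mult_defect \<Phi>p a b - mult_defect \<Phi>m a b \<in> D"
proof -
  have "mult_defect \<Phi>p a b - mult_defect \<Phi>m a b =
      (\<Phi>p (a * b) - \<Phi>m (a * b)) - (\<Phi>p a - \<Phi>m a) * \<Phi>p b - \<Phi>m a * (\<Phi>p b - \<Phi>m b)"
    by (simp add: mult_defect_def algebra_simps)
  then show ?thesis by (simp only: D_closed(3,5,6) difference_in_D \<Phi>_in_E)
qed

section \<open>From cycles to equal deficiency\<close>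

text \<open>\<open>D\<close> need not be closed under \<open>star\<close>, because the maps respect
  adjoints only modulo \<open>C0\<close>. Annihilating the adjoints is instead a closed ideal
  condition that holds on the generators.\<close>

lemma annihilates_star_D:
  assumes homogeneous: "homogeneous_asym_star \<Phi>p" "homogeneous_asym_star \<Phi>m"
    and annihilates: "\<And>x. x \<in> D \<Longrightarrow> m * x \<in> C0"
    and "x \<in> D"
  shows "m * star x \<in> C0"
proof -
  \<comment> \<open>\<open>star (y * x)\<close> puts \<open>star y\<close> after
    \<open>star x\<close>, but \<open>star (x * y)\<close> puts it between \<open>m\<close> and
    \<open>star x\<close>. The test set is therefore made stable under right multiplication by
    \<open>E\<close>; \<open>m\<close> is inserted separately since \<open>E\<close> need not have a
    unit.\<close>
  let ?J = "{x \<in> E. \<forall>y \<in> insert m ((*) m ` E). y * star x \<in> C0}"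
  have "D \<subseteq> ?J"
  proof (rule D_minimal)
    have "closed (E \<inter> (\<Inter>y \<in> insert m ((*) m ` E). {x. y * star x \<in> C0}))"
      using cstar_subalgebra_E
      by (intro closed_Int closed_INT ballI closed_C0_vimage continuous_intros)
        (auto simp: cstar_subalgebra_def)
    moreover have "E \<inter> (\<Inter>y \<in> insert m ((*) m ` E). {x. y * star x \<in> C0}) = ?J" by auto
    ultimately have "closed ?J" by simp
    moreover have "x * y \<in> ?J \<and> y * x \<in> ?J" if x: "x \<in> ?J" and y: "y \<in> E" for x y
    proof -
      have "m * star y * star x \<in> C0"
        using x y by (auto simp: E_closed)
      moreover have "m * e * star y * star x \<in> C0" if "e \<in> E" for e
        using x y that E_closed(2)[OF that E_closed(3)[OF y y]] by (auto simp: mult.assoc)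
      ultimately show ?thesis
        using x y C0_mult_right by (auto simp: E_closed star_mult mult.assoc[symmetric])
    qed
    ultimately show "closed_ideal_of E ?J"
      using cstar_subalgebra_E
      by (auto simp: closed_ideal_of_def cstar_subalgebra_def star_zero C0_zero star_add
          distrib_left C0_add star_scaleC mult_scaleC_right C0_scaleC)
  next
    fix a
    have "star (\<Phi>p a - \<Phi>m a) - (\<Phi>p (star a) - \<Phi>m (star a)) \<in> C0"
    proof -
      have "(\<Phi>m (star a) - star (\<Phi>m a)) - (\<Phi>p (star a) - star (\<Phi>p a)) \<in> C0"
        using homogeneous
        by (intro C0_diff[where x = "_ - _" and y = "_ - _"]) (auto simp: homogeneous_asym_star_def)
      then show ?thesis by (simp add: star_diff algebra_simps)
    qed
    then have "y * star (\<Phi>p a - \<Phi>m a) - y * (\<Phi>p (star a) - \<Phi>m (star a)) \<in> C0" for y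
      by (metis C0_mult_left right_diff_distrib)
    moreover have "y * (\<Phi>p (star a) - \<Phi>m (star a)) \<in> C0" if "y \<in> insert m ((*) m ` E)" for y
      using that annihilates D_closed(6)[OF difference_in_D] difference_in_D
      by (auto simp: mult.assoc)
    ultimately show "\<Phi>p a - \<Phi>m a \<in> ?J"
      using C0_diff_cancel by (auto simp: E_closed \<Phi>_in_E)
  qed
  with \<open>x \<in> D\<close> show ?thesis by auto
qed

text \<open>Arbitrary \<open>mp\<close> and \<open>mm\<close> let one induction serve both the
  additive and the multiplicative defect.\<close>

lemma mult_word_diff_C0:
  assumes homogeneous: "homogeneous_asym_star \<Phi>p" "homogeneous_asym_star \<Phi>m"
    and annihilates: "\<And>x. x \<in> D \<Longrightarrow> mp * x \<in> C0" "\<And>x. x \<in> D \<Longrightarrow> mm * x \<in> C0"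
    and diff: "mp - mm \<in> D"
  shows "mult_word \<Phi>p mp cs - mult_word \<Phi>m mm cs \<in> C0"
proof (induction cs rule: rev_induct)
  case Nil
  have "mp * star (mp - mm) - mm * star (mp - mm) \<in> C0"
    using annihilates_star_D[OF homogeneous annihilates(1) diff]
      annihilates_star_D[OF homogeneous annihilates(2) diff] by (rule C0_diff)
  then have "(mp - mm) * star (mp - mm) \<in> C0"
    by (simp add: left_diff_distrib)
  then have "mp - mm \<in> C0" by (rule C0_mult_star_self)
  then show ?case by (simp add: mult_word_def)
next
  case (snoc c cs)
  \<comment> \<open>The last factor of the word is absorbed into \<open>x\<close>, which stays in
    \<open>D\<close> because \<open>D\<close> is an ideal of \<open>E\<close>.\<close>
  have word: "mult_word \<Phi>p mp cs * x \<in> C0" if "x \<in> D" for x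
    using that
  proof (induction cs arbitrary: x rule: rev_induct)
    case Nil
    then show ?case by (simp add: mult_word_def annihilates)
  next
    case (snoc c cs)
    then show ?case by (simp add: mult_word_snoc mult.assoc D_closed \<Phi>_in_E)
  qed
  have "mult_word \<Phi>p mp (cs @ [c]) - mult_word \<Phi>m mm (cs @ [c]) =
      (mult_word \<Phi>p mp cs - mult_word \<Phi>m mm cs) * \<Phi>m c + mult_word \<Phi>p mp cs * (\<Phi>p c - \<Phi>m c)"
    by (simp add: mult_word_snoc algebra_simps)
  then show ?case
    using snoc word difference_in_D by (simp add: C0_add C0_mult_right)
qed

section \<open>From equal deficiency to cycles\<close>

text \<open>Only words in \<open>\<Phi>p\<close> are tested, which is what equal deficiency controls
  directly. Admitting every length makes the set stable under right multiplication by
  \<open>\<Phi>p a\<close>.\<close>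

definition annihilators :: "(nnreal \<Rightarrow>\<^sub>C 'b) set" where
  "annihilators = {v. \<forall>cs c. mult_word \<Phi>p v cs * (\<Phi>p c - \<Phi>m c) \<in> C0}"

lemma closed_annihilators: "closed annihilators"
proof -
  have "annihilators = (\<Inter>cs. \<Inter>c. {v. mult_word \<Phi>p v cs * (\<Phi>p c - \<Phi>m c) \<in> C0})"
    by (auto simp: annihilators_def)
  then show ?thesis
    by (auto intro!: closed_INT closed_C0_vimage continuous_intros continuous_on_mult_word)
qed

lemma C0_subset_annihilators: "C0 \<subseteq> annihilators"
  by (auto simp: annihilators_def intro: mult_word_C0 C0_mult_right)

lemma annihilators_add: "v \<in> annihilators \<Longrightarrow> w \<in> annihilators \<Longrightarrow> v + w \<in> annihilators"
  by (simp add: annihilators_def mult_word_add distrib_right C0_add)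

lemma annihilators_scaleC: "v \<in> annihilators \<Longrightarrow> c *\<^sub>C v \<in> annihilators"
  by (simp add: annihilators_def mult_word_scaleC mult_scaleC_left C0_scaleC)

lemma annihilators_diff: "v \<in> annihilators \<Longrightarrow> w \<in> annihilators \<Longrightarrow> v - w \<in> annihilators"
  using annihilators_add[of v "(- 1) *\<^sub>C w"] annihilators_scaleC[of w "- 1"]
  by (simp add: scaleC_minus_one)

lemma annihilators_difference:
  assumes "v \<in> annihilators" shows "v * (\<Phi>p c - \<Phi>m c) \<in> C0"
proof -
  have "mult_word \<Phi>p v [] * (\<Phi>p c - \<Phi>m c) \<in> C0"
    using assms unfolding annihilators_def by blast
  then show ?thesis by (simp add: mult_word_def)
qed

lemma annihilators_mult_\<Phi>p:
  assumes "v \<in> annihilators" shows "v * \<Phi>p a \<in> annihilators"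
proof -
  \<comment> \<open>Testing \<open>v * \<Phi>p a\<close> on \<open>cs\<close> is testing
    \<open>v\<close> on the longer word \<open>a # cs\<close>.\<close>
  have "mult_word \<Phi>p v (a # cs) * (\<Phi>p c - \<Phi>m c) \<in> C0" for cs c
    using assms unfolding annihilators_def by blast
  then show ?thesis by (simp add: annihilators_def mult_word_def)
qed

text \<open>Replacing \<open>\<Phi>p a\<close> by \<open>\<Phi>m a\<close> costs
  \<open>v * (\<Phi>p a - \<Phi>m a)\<close>, which lies in \<open>C0\<close> by the test on the
  empty word.\<close>

lemma annihilators_mult_\<Phi>m:
  assumes "v \<in> annihilators" shows "v * \<Phi>m a \<in> annihilators"
proof -
  have "v * \<Phi>p a - v * (\<Phi>p a - \<Phi>m a) \<in> annihilators"
    using assms annihilators_difference annihilators_mult_\<Phi>p C0_subset_annihilators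
    by (intro annihilators_diff) auto
  then show ?thesis by (simp add: algebra_simps)
qed

lemma annihilators_mult_E:
  assumes homogeneous: "homogeneous_asym_star \<Phi>p" "homogeneous_asym_star \<Phi>m"
    and "v \<in> annihilators" "e \<in> E"
  shows "v * e \<in> annihilators"
proof -
  \<comment> \<open>Both \<open>e\<close> and \<open>star e\<close> are required so that
    \<open>?L\<close> is closed under \<open>star\<close>.\<close>
  let ?L = "{e. \<forall>v\<in>annihilators. v * e \<in> annihilators \<and> v * star e \<in> annihilators}"
  have zero: "0 \<in> annihilators"
    using C0_zero C0_subset_annihilators by auto
  \<comment> \<open>Modulo \<open>C0\<close>, \<open>star (\<Phi> a)\<close> is the value
    \<open>\<Phi> (star a)\<close>, so adjoints of generators reduce to generators.\<close>
  have star: "v * star (\<Phi> a) \<in> annihilators"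
    if \<Phi>: "homogeneous_asym_star \<Phi>" "\<And>v a. v \<in> annihilators \<Longrightarrow> v * \<Phi> a \<in> annihilators"
      and v: "v \<in> annihilators" for \<Phi> v and a :: 'a
  proof -
    have "v * (\<Phi> (star a) - star (\<Phi> a)) \<in> C0"
      using \<Phi>(1) by (intro C0_mult_left) (simp add: homogeneous_asym_star_def)
    then have "v * \<Phi> (star a) - v * (\<Phi> (star a) - star (\<Phi> a)) \<in> annihilators"
      using \<Phi>(2) v C0_subset_annihilators by (intro annihilators_diff) auto
    then show ?thesis by (simp add: algebra_simps)
  qed
  have "E \<subseteq> ?L"
    unfolding generated_algebra_def
  proof (rule hull_minimal)
    have "?L = (\<Inter>v\<in>annihilators.
        (\<lambda>e. v * e) -` annihilators \<inter> (\<lambda>e. v * star e) -` annihilators)"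
      by auto
    moreover have "closed \<dots>"
      by (intro closed_INT ballI closed_Int closed_vimage closed_annihilators continuous_intros)
    ultimately have "closed ?L" by simp
    then show "cstar_subalgebra ?L"
      by (auto simp: cstar_subalgebra_def zero star_zero star_add distrib_left annihilators_add
          star_mult star_star star_scaleC mult_scaleC_right annihilators_scaleC mult.assoc[symmetric])
    show "range \<Phi>p \<union> range \<Phi>m \<subseteq> ?L"
      using star homogeneous annihilators_mult_\<Phi>p annihilators_mult_\<Phi>m by auto
  qed
  with assms show ?thesis by auto
qed

text \<open>Quantifying over all \<open>v\<close> at once makes \<open>?J\<close> a left ideal: in
  \<open>v * (y * x)\<close> the factor \<open>v * y\<close> is again an annihilator.\<close>

lemma annihilators_mult_D:
  assumes homogeneous: "homogeneous_asym_star \<Phi>p" "homogeneous_asym_star \<Phi>m"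
    and "v \<in> annihilators" "x \<in> D"
  shows "v * x \<in> C0"
proof -
  let ?J = "{x \<in> E. \<forall>v\<in>annihilators. v * x \<in> C0}"
  have "D \<subseteq> ?J"
  proof (rule D_minimal)
    have "?J = E \<inter> (\<Inter>v\<in>annihilators. {x. v * x \<in> C0})" by auto
    moreover have "closed \<dots>"
      using cstar_subalgebra_E
      by (intro closed_Int closed_INT ballI closed_C0_vimage continuous_intros)
        (auto simp: cstar_subalgebra_def)
    ultimately have "closed ?J" by simp
    then show "closed_ideal_of E ?J"
      using cstar_subalgebra_E annihilators_mult_E[OF homogeneous]
      by (auto simp: closed_ideal_of_def cstar_subalgebra_def C0_zero distrib_left C0_add
          mult_scaleC_right C0_scaleC C0_mult_right mult.assoc[symmetric])
    show "\<Phi>p a - \<Phi>m a \<in> ?J" for a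
      by (simp add: E_closed \<Phi>_in_E annihilators_difference)
  qed
  with assms show ?thesis by auto
qed

lemma same_words_annihilators:
  assumes words: "\<And>cs. mult_word \<Phi>p mp cs - mult_word \<Phi>m mm cs \<in> C0"
  shows "mp \<in> annihilators" "mm \<in> annihilators"
proof -
  show mp: "mp \<in> annihilators"
    unfolding annihilators_def
  proof (intro CollectI allI)
    fix cs c
    \<comment> \<open>Equal deficiency for \<open>cs @ [c]\<close>, minus that for \<open>cs\<close>
      multiplied by \<open>\<Phi>m c\<close>, cancels every term with \<open>mm\<close>.\<close>
    have "mult_word \<Phi>p mp cs * (\<Phi>p c - \<Phi>m c) =
        (mult_word \<Phi>p mp (cs @ [c]) - mult_word \<Phi>m mm (cs @ [c]))
        - (mult_word \<Phi>p mp cs - mult_word \<Phi>m mm cs) * \<Phi>m c"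
      by (simp add: mult_word_snoc algebra_simps)
    then show "mult_word \<Phi>p mp cs * (\<Phi>p c - \<Phi>m c) \<in> C0"
      by (simp only: words C0_diff C0_mult_right)
  qed
  \<comment> \<open>The empty word gives \<open>mp - mm\<close> in \<open>C0\<close>, which
    transfers membership from \<open>mp\<close> to \<open>mm\<close>.\<close>
  have "mp - mm \<in> annihilators"
    using words[of "[]"] C0_subset_annihilators by (auto simp: mult_word_def)
  with mp have "mp - (mp - mm) \<in> annihilators" by (rule annihilators_diff)
  then show "mm \<in> annihilators" by simp
qed

end

theorem proposition1p3:
  fixes \<Phi>p \<Phi>m :: "'a::cstar_algebra \<Rightarrow> (nnreal \<Rightarrow>\<^sub>C 'b::cstar_algebra)"
  assumes "separable_space (euclidean :: 'a topology)"
    and "stable_cstar TYPE('b)"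
    and "sigma_unital TYPE('b)"
    and "continuous_on UNIV \<Phi>p"
    and "continuous_on UNIV \<Phi>m"
  shows "compact_asymptotic_KK_cycle \<Phi>p \<Phi>m \<longleftrightarrow> same_deficiency \<Phi>p \<Phi>m"
proof
  assume "compact_asymptotic_KK_cycle \<Phi>p \<Phi>m"
  then show "same_deficiency \<Phi>p \<Phi>m"
    by (simp add: compact_asymptotic_KK_cycle_def same_deficiency_def mult_word_diff_C0
        add_defect_diff_in_D mult_defect_diff_in_D)
next
  assume same: "same_deficiency \<Phi>p \<Phi>m"
  then have homogeneous: "homogeneous_asym_star \<Phi>p" "homogeneous_asym_star \<Phi>m"
    by (simp_all add: same_deficiency_def)
  have "add_defect \<Phi> a b \<in> annihilators \<Phi>p \<Phi>m \<and> mult_defect \<Phi> a b \<in> annihilators \<Phi>p \<Phi>m"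
    if "\<Phi> \<in> {\<Phi>p, \<Phi>m}" for \<Phi> a b
    using that same
      same_words_annihilators[of \<Phi>p "add_defect \<Phi>p a b" \<Phi>m "add_defect \<Phi>m a b"]
      same_words_annihilators[of \<Phi>p "mult_defect \<Phi>p a b" \<Phi>m "mult_defect \<Phi>m a b"]
    by (auto simp: same_deficiency_def)
  then show "compact_asymptotic_KK_cycle \<Phi>p \<Phi>m"
    unfolding compact_asymptotic_KK_cycle_def
    using homogeneous annihilators_mult_D by blast
qed

end
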